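(* Let $K$ be a number field of degree $n$ over $\mathbb{Q}$ with ring of integers $O_K$, and let $O_{K,n}$ be the set of elements of $O_K$ of degree exactly $n$ over $\mathbb{Q}$. Then $O_{K,n}$ is polynomially dense in $O_K$; that is, $\{f\in K[X] \mid f(O_{K,n})\subset O_K\}=\{f\in K[X]\mid f(O_K)\subset O_K\}$.
   Context: A subset $S$ of a domain $D$ with quotient field $K$ is called polynomially dense in $D$ if $\mathrm{Int}(S,D)=\{f\in K[X]\mid f(S)\subset D\}$ equals $\mathrm{Int}(D)=\{f\in K[X]\mid f(D)\subset D\}$. *)

theory Defs
  imports Complex_Main "HOL-Computational_Algebra.Polynomial_Factorial"
begin

text \<open>Every field of characteristic zero as a vector space over \<open>\<rat>\<close>.\<close>

global_interpretation rat_vs: vector_space "\<lambda>(q::rat) (x::'a::field_char_0). of_rat q * x"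
  by unfold_locales (simp_all add: algebra_simps of_rat_add of_rat_mult)

definition subfield_set :: "'a::field set \<Rightarrow> bool" where
  "subfield_set K \<longleftrightarrow> 0 \<in> K \<and> 1 \<in> K \<and>
     (\<forall>x\<in>K. \<forall>y\<in>K. x + y \<in> K \<and> x * y \<in> K) \<and>
     (\<forall>x\<in>K. - x \<in> K \<and> inverse x \<in> K)"

text \<open>
  A number field is a subfield, of finite dimension over \<open>\<rat>\<close>, of an ambient field of
  characteristic zero. The ambient field is arbitrary; it may be \<open>K\<close> itself (\<open>K = UNIV\<close>), the
  complex numbers, etc. The degree of \<open>K\<close> is \<open>rat_vs.dim K\<close>.
\<close>

definition number_field :: "'a::field_char_0 set \<Rightarrow> bool" where
  "number_field K \<longleftrightarrow> subfield_set K \<and> (\<exists>B. finite B \<and> rat_vs.span B = K)"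

definition ring_of_integers :: "'a::field_char_0 set \<Rightarrow> 'a set" where
  "ring_of_integers K = {x \<in> K. algebraic_int x}"

text \<open>The next two notions are only meaningful for \<open>x\<close> algebraic over \<open>\<rat>\<close>.\<close>

definition rat_minpoly :: "'a::field_char_0 \<Rightarrow> rat poly" where
  "rat_minpoly x =
     (THE p. lead_coeff p = 1 \<and> irreducible p \<and> poly (map_poly of_rat p) x = 0)"

definition rat_degree :: "'a::field_char_0 \<Rightarrow> nat" where
  "rat_degree x = degree (rat_minpoly x)"

definition integers_of_degree :: "'a::field_char_0 set \<Rightarrow> nat \<Rightarrow> 'a set" where
  "integers_of_degree K n = {x \<in> ring_of_integers K. rat_degree x = n}"

text \<open>The quotient field of a subring \<open>D\<close>, formed inside the ambient field.\<close>

definition quotient_field :: "'a::field set \<Rightarrow> 'a set" where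
  "quotient_field D = {a / b | a b. a \<in> D \<and> b \<in> D \<and> b \<noteq> 0}"

text \<open>\<open>int_valued K S D\<close> is \<open>{f \<in> K[X] | f(S) \<subseteq> D}\<close>.\<close>

definition int_valued :: "'a::field set \<Rightarrow> 'a set \<Rightarrow> 'a set \<Rightarrow> 'a poly set" where
  "int_valued K S D = {f. (\<forall>i. coeff f i \<in> K) \<and> poly f ` S \<subseteq> D}"

definition polynomially_dense :: "'a::field set \<Rightarrow> 'a set \<Rightarrow> bool" where
  "polynomially_dense S D \<longleftrightarrow> S \<subseteq> D \<and>
     int_valued (quotient_field D) S D = int_valued (quotient_field D) D D"

end

theory Submission
  imports Defs "Jordan_Normal_Form.Char_Poly"
begin

text \<open>
  Let \<open>f\<close> map the integers of degree \<open>n\<close> to integers, let \<open>\<alpha> \<in> O\<^sub>K\<close>, let \<open>\<theta>\<close> be a primitive element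
  of \<open>K\<close>, and choose \<open>d > 0\<close> such that \<open>d \<theta>\<close> and the coefficients of \<open>d f\<close> are integral. For almost
  all integers \<open>m\<close> the element \<open>\<gamma> = \<alpha> + d\<^sup>2 m \<theta>\<close> is again primitive, so \<open>f(\<gamma>)\<close> is integral.
  Since \<open>\<gamma> - \<alpha>\<close> divides \<open>d f(\<gamma>) - d f(\<alpha>)\<close> with integral quotient \<open>s\<close>,
  \<open>f(\<gamma>) - f(\<alpha>) = m (d \<theta>) s\<close> is integral, and hence so is \<open>f(\<alpha>)\<close>.
\<close>

section \<open>Integral elements\<close>

text \<open>One development serves three coefficient maps: integers and rationals into a field, and
  rational polynomials into polynomials over that field. The target is a domain, so that a nonzero
  kernel vector forces a determinant to vanish.\<close>

locale integral_hom = comm_ring_hom h for h :: "'r::comm_ring_1 \<Rightarrow> 's::idom"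
begin

definition integral :: "'s \<Rightarrow> bool" where
  "integral x \<longleftrightarrow> (\<exists>p. monic p \<and> poly (map_poly h p) x = 0)"

text \<open>The span of an indexed family rather than of a set, because the products of powers used
  below may coincide.\<close>

definition lin_span :: "'i set \<Rightarrow> ('i \<Rightarrow> 's) \<Rightarrow> 's set" where
  "lin_span I b = range (\<lambda>c. \<Sum>i\<in>I. h (c i) * b i)"

lemma lin_span_base: "finite I \<Longrightarrow> i \<in> I \<Longrightarrow> b i \<in> lin_span I b"
  unfolding lin_span_def
  by (rule range_eqI[where x = "\<lambda>j. if j = i then 1 else 0"])
     (simp add: if_distrib[of h] if_distrib[of "\<lambda>c. c * _"] cong: if_cong)

lemma lin_span_0: "0 \<in> lin_span I b"
  unfolding lin_span_def by (rule range_eqI[where x = "\<lambda>_. 0"]) simp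

lemma lin_span_add: "u \<in> lin_span I b \<Longrightarrow> v \<in> lin_span I b \<Longrightarrow> u + v \<in> lin_span I b"
proof -
  assume "u \<in> lin_span I b" "v \<in> lin_span I b"
  then obtain c d where "u = (\<Sum>i\<in>I. h (c i) * b i)" "v = (\<Sum>i\<in>I. h (d i) * b i)"
    unfolding lin_span_def by blast
  then have "u + v = (\<Sum>i\<in>I. h (c i + d i) * b i)"
    by (simp add: hom_add distrib_right sum.distrib)
  then show ?thesis unfolding lin_span_def by (rule range_eqI[where x = "\<lambda>i. c i + d i"])
qed

lemma lin_span_scale: "u \<in> lin_span I b \<Longrightarrow> h r * u \<in> lin_span I b"
proof -
  assume "u \<in> lin_span I b"
  then obtain c where "u = (\<Sum>i\<in>I. h (c i) * b i)"
    unfolding lin_span_def by blast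
  then have "h r * u = (\<Sum>i\<in>I. h (r * c i) * b i)"
    by (simp add: hom_mult sum_distrib_left mult.assoc)
  then show ?thesis unfolding lin_span_def by (rule range_eqI[where x = "\<lambda>i. r * c i"])
qed

lemma lin_span_sum: "(\<And>j. j \<in> J \<Longrightarrow> u j \<in> lin_span I b) \<Longrightarrow> sum u J \<in> lin_span I b"
  by (induction J rule: infinite_finite_induct) (auto intro: lin_span_0 lin_span_add)

lemma lin_span_mult:
  assumes "\<And>i. i \<in> I \<Longrightarrow> x * b i \<in> lin_span I b" and "u \<in> lin_span I b"
  shows "x * u \<in> lin_span I b"
proof -
  obtain c where "u = (\<Sum>i\<in>I. h (c i) * b i)"
    using assms(2) unfolding lin_span_def by blast
  then have "x * u = (\<Sum>i\<in>I. h (c i) * (x * b i))"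
    by (simp add: sum_distrib_left algebra_simps)
  then show ?thesis using assms(1) by (auto intro!: lin_span_sum lin_span_scale)
qed

text \<open>\<open>x\<close> is an eigenvalue of the matrix of coefficients, with eigenvector \<open>b\<close>.\<close>

lemma integral_if_stable_lessThan:
  fixes b :: "nat \<Rightarrow> 's"
  assumes stable: "\<And>i. i < n \<Longrightarrow> x * b i \<in> lin_span {..<n} b" and k: "k < n" "b k \<noteq> 0"
  shows "integral x"
proof -
  have "\<exists>c. x * b i = (\<Sum>j<n. h (c j) * b j)" if "i < n" for i
    using stable[OF that] unfolding lin_span_def by blast
  then obtain c where c: "\<And>i. i < n \<Longrightarrow> x * b i = (\<Sum>j<n. h (c i j) * b j)" by metis
  define A where "A = mat n n (\<lambda>(i, j). c i j)"
  have A: "A \<in> carrier_mat n n" unfolding A_def by simp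
  interpret mp: map_poly_comm_ring_hom h ..
  \<comment> \<open>Evaluation at \<open>x\<close> is a ring homomorphism, hence commutes with
    determinants.\<close>
  interpret ev: comm_ring_hom "\<lambda>p. poly (map_poly h p) x"
    by unfold_locales (simp_all add: mp.hom_add mp.hom_mult)
  have ev_const: "poly (map_poly h [:r:]) x = h r" for r
    by (cases "r = 0") (simp_all)
  \<comment> \<open>\<open>N\<close> is \<open>x\<close> times the identity minus the image of
    \<open>A\<close> under \<open>h\<close>, so the vector of the \<open>b i\<close> lies in its
    kernel.\<close>
  define N where "N = map_mat (\<lambda>p. poly (map_poly h p) x) (char_poly_matrix A)"
  have N: "N \<in> carrier_mat n n" unfolding N_def using A by simp
  have N_ij: "N $$ (i, j) = (if i = j then x else 0) - h (c i j)" if "i < n" "j < n" for i j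
    using that unfolding N_def char_poly_matrix_def A_def
    by (auto simp: mp.hom_add hom_uminus ev_const)
  have "N *\<^sub>v vec n b = 0\<^sub>v n"
  proof (rule eq_vecI)
    fix i assume "i < dim_vec (0\<^sub>v n :: 's vec)"
    then have i: "i < n" by simp
    have "(N *\<^sub>v vec n b) $ i = (\<Sum>j<n. N $$ (i, j) * b j)"
      using N i by (simp add: scalar_prod_def lessThan_atLeast0)
    also have "\<dots> = (\<Sum>j<n. ((if i = j then x else 0) - h (c i j)) * b j)"
      using i by (intro sum.cong) (auto simp: N_ij)
    also have "\<dots> = (\<Sum>j<n. (if i = j then x * b j else 0)) - (\<Sum>j<n. h (c i j) * b j)"
      unfolding sum_subtractf[symmetric] by (intro sum.cong) (auto simp: algebra_simps)
    also have "\<dots> = 0" using i c[OF i] by simp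
    finally show "(N *\<^sub>v vec n b) $ i = 0\<^sub>v n $ i" using i by simp
  qed (use N in simp)
  moreover have "vec n b \<noteq> 0\<^sub>v n" using k by (metis index_vec index_zero_vec(1))
  ultimately have "det N = 0"
    using det_0_iff_vec_prod_zero[OF N] by (metis vec_carrier)
  then have "poly (map_poly h (char_poly A)) x = 0"
    unfolding N_def char_poly_def ev.hom_det .
  moreover have "monic (char_poly A)" using degree_monic_char_poly[OF A] by simp
  ultimately show ?thesis unfolding integral_def by blast
qed

text \<open>An enumeration of \<open>I\<close> provides the matrix indices. Later index sets consist
  of pairs or of field elements.\<close>

lemma integral_if_stable:
  assumes "finite I" and stable: "\<And>i. i \<in> I \<Longrightarrow> x * b i \<in> lin_span I b"
    and "k \<in> I" "b k \<noteq> 0"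
  shows "integral x"
proof -
  obtain g where g: "bij_betw g {..<card I} I"
    using ex_bij_betw_nat_finite[OF assms(1)] by (auto simp: lessThan_atLeast0)
  have "lin_span I b \<subseteq> lin_span {..<card I} (b \<circ> g)"
  proof
    fix u assume "u \<in> lin_span I b"
    then obtain c where "u = (\<Sum>i\<in>I. h (c i) * b i)" unfolding lin_span_def by blast
    also have "\<dots> = (\<Sum>j<card I. h ((c \<circ> g) j) * (b \<circ> g) j)"
      using sum.reindex_bij_betw[OF g, of "\<lambda>i. h (c i) * b i"] by simp
    finally show "u \<in> lin_span {..<card I} (b \<circ> g)" unfolding lin_span_def by blast
  qed
  moreover obtain j where "j < card I" "g j = k"
    using g assms(3) unfolding bij_betw_def by (metis imageE lessThan_iff)
  moreover have "g i \<in> I" if "i < card I" for i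
    using g that by (meson bij_betwE lessThan_iff)
  ultimately show ?thesis
    using assms(4) stable by (intro integral_if_stable_lessThan[of "card I" x "b \<circ> g" j]) auto
qed

section \<open>Closure of integral elements under ring operations\<close>

text \<open>Multiplication by \<open>x\<close> and by \<open>y\<close> maps the span of the finitely
  many products \<open>x ^ i * y ^ j\<close> below the two degrees into itself: the monic relations
  rewrite the top powers. Hence \<open>x + y\<close> and \<open>x * y\<close> also preserve this
  span, which contains 1.\<close>

lemma integral_add_mult:
  assumes "integral x" "integral y"
  shows "integral (x + y)" "integral (x * y)"
proof -
  obtain p q where p: "monic p" "poly (map_poly h p) x = 0"
    and q: "monic q" "poly (map_poly h q) y = 0"
    using assms unfolding integral_def by blast
  have power_eq: "z ^ degree r = (\<Sum>i<degree r. h (- coeff r i) * z ^ i)"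
    if "monic r" "poly (map_poly h r) z = 0" for r :: "'r poly" and z
  proof -
    have "degree (map_poly h r) = degree r"
      using that(1) by (intro degree_map_poly) auto
    then have "0 = (\<Sum>i\<le>degree r. h (coeff r i) * z ^ i)"
      using that(2) by (simp add: poly_altdef coeff_map_poly)
    also have "\<dots> = z ^ degree r + (\<Sum>i<degree r. h (coeff r i) * z ^ i)"
      using that(1) by (simp flip: lessThan_Suc_atMost)
    finally show ?thesis by (simp add: hom_uminus sum_negf eq_neg_iff_add_eq_0)
  qed
  \<comment> \<open>In degree 0 the relation would read 1 = 0. Positivity puts \<open>(0, 0)\<close>
    into \<open>I\<close>, where \<open>b\<close> takes the value 1.\<close>
  have pos: "degree r > 0" if "monic r" "poly (map_poly h r) z = 0" for r :: "'r poly" and z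
    using power_eq[OF that] by (cases "degree r") auto
  define I where "I = {..<degree p} \<times> {..<degree q}"
  define b where "b = (\<lambda>(i, j). x ^ i * y ^ j)"
  have I: "finite I" unfolding I_def by simp
  have x_stable: "x * b ij \<in> lin_span I b" if "ij \<in> I" for ij
  proof -
    obtain i j where ij: "ij = (i, j)" "i < degree p" "j < degree q"
      using \<open>ij \<in> I\<close> unfolding I_def by auto
    show ?thesis
    proof (cases "Suc i < degree p")
      case True
      have "x * b ij = b (Suc i, j)" unfolding b_def ij by simp
      then show ?thesis using True ij(3) I by (auto simp: I_def intro!: lin_span_base)
    next
      case False
      then have "Suc i = degree p" using ij(2) by simp
      then have "x * b ij = x ^ degree p * y ^ j"
        unfolding b_def ij by (metis mult.assoc power_Suc prod.simps(2))
      also have "\<dots> = (\<Sum>k<degree p. h (- coeff p k) * b (k, j))"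
        by (subst power_eq[OF p]) (simp add: b_def sum_distrib_right mult.assoc)
      finally show ?thesis
        using ij(3) I by (auto simp: I_def intro!: lin_span_sum lin_span_scale lin_span_base)
    qed
  qed
  have y_stable: "y * b ij \<in> lin_span I b" if "ij \<in> I" for ij
  proof -
    obtain i j where ij: "ij = (i, j)" "i < degree p" "j < degree q"
      using \<open>ij \<in> I\<close> unfolding I_def by auto
    show ?thesis
    proof (cases "Suc j < degree q")
      case True
      have "y * b ij = b (i, Suc j)" unfolding b_def ij by simp
      then show ?thesis using True ij(2) I by (auto simp: I_def intro!: lin_span_base)
    next
      case False
      then have "Suc j = degree q" using ij(3) by simp
      then have "y * b ij = x ^ i * y ^ degree q"
        unfolding b_def ij by (metis mult.left_commute power_Suc prod.simps(2))
      also have "\<dots> = (\<Sum>k<degree q. h (- coeff q k) * b (i, k))"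
        by (subst power_eq[OF q]) (simp add: b_def sum_distrib_left algebra_simps)
      finally show ?thesis
        using ij(2) I by (auto simp: I_def intro!: lin_span_sum lin_span_scale lin_span_base)
    qed
  qed
  have one: "(0, 0) \<in> I" "b (0, 0) \<noteq> 0"
    using pos[OF p] pos[OF q] unfolding I_def b_def by auto
  show "integral (x + y)"
    by (rule integral_if_stable[where I = I and b = b and k = "(0, 0)", OF I _ one])
       (simp add: distrib_right lin_span_add x_stable y_stable)
  show "integral (x * y)"
    by (rule integral_if_stable[where I = I and b = b and k = "(0, 0)", OF I _ one])
       (simp add: mult.assoc lin_span_mult[OF x_stable] y_stable)
qed

lemma integral_hom: "integral (h r)"
  unfolding integral_def by (rule exI[of _ "[:- r, 1:]"]) (simp add: hom_uminus)

lemma integral_sum: "(\<And>j. j \<in> J \<Longrightarrow> integral (u j)) \<Longrightarrow> integral (sum u J)"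
  using integral_hom[of 0]
  by (induction J rule: infinite_finite_induct) (auto intro: integral_add_mult)

lemma integral_power: "integral x \<Longrightarrow> integral (x ^ k)"
  using integral_hom[of 1] by (induction k) (auto intro: integral_add_mult)

lemma integral_poly:
  assumes "\<And>i. integral (coeff f i)" "integral x"
  shows "integral (poly f x)"
  unfolding poly_altdef using assms by (intro integral_sum integral_add_mult integral_power)

lemma integral_poly_hom: "integral x \<Longrightarrow> integral (poly (map_poly h p) x)"
  by (rule integral_poly) (simp_all add: coeff_map_poly integral_hom)

text \<open>The quotient is built by Horner's scheme: if \<open>s\<close> is the quotient for
  \<open>g\<close>, then \<open>poly g y + x * s\<close> is the one for \<open>pCons c g\<close>,
  since \<open>c\<close> cancels.\<close>

lemma integral_poly_diff:
  assumes "\<And>i. integral (coeff f i)" "integral x" "integral y"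
  shows "\<exists>s. integral s \<and> poly f y - poly f x = (y - x) * s"
  using assms(1)
proof (induction f)
  case 0
  show ?case using integral_hom[of 0] by (intro exI[of _ 0]) simp
next
  case (pCons c g)
  have g: "integral (coeff g i)" for i using pCons.prems[of "Suc i"] by simp
  then obtain s where s: "integral s" "poly g y - poly g x = (y - x) * s"
    using pCons.IH by blast
  have "poly (pCons c g) y - poly (pCons c g) x = (y - x) * poly g y + x * (poly g y - poly g x)"
    by (simp add: algebra_simps)
  then have "poly (pCons c g) y - poly (pCons c g) x = (y - x) * (poly g y + x * s)"
    unfolding s(2) by (simp add: algebra_simps)
  moreover have "integral (poly g y + x * s)"
    by (intro integral_add_mult integral_poly g s(1) assms(2,3))
  ultimately show ?case by blast
qed

end

section \<open>Simple extensions of the rational numbers\<close>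

global_interpretation int_integral: integral_hom "of_int :: int \<Rightarrow> 'a::field_char_0"
  ..

global_interpretation rat_integral: integral_hom "of_rat :: rat \<Rightarrow> 'a::field_char_0"
  ..

text \<open>Coefficients in Q[T] allow a relation for \<alpha> + T \<beta> with an indeterminate T,
  the polynomial \<open>[:\<alpha>, \<beta>:]\<close>.\<close>

global_interpretation rat_poly_integral:
  integral_hom "map_poly of_rat :: rat poly \<Rightarrow> 'a::field_char_0 poly"
proof -
  interpret map_poly_comm_ring_hom "of_rat :: rat \<Rightarrow> 'a" ..
  show "integral_hom (map_poly of_rat :: rat poly \<Rightarrow> 'a poly)" ..
qed

lemma algebraic_int_iff_integral: "algebraic_int x \<longleftrightarrow> int_integral.integral x"
  unfolding algebraic_int_altdef_ipoly int_integral.integral_def by auto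

abbreviation rpoly :: "rat poly \<Rightarrow> 'a::field_char_0 \<Rightarrow> 'a" where
  "rpoly p x \<equiv> poly (map_poly of_rat p) x"

lemma rpoly_pCons: "rpoly (pCons c p) x = of_rat c + x * rpoly p x"
  by (cases "c = 0 \<and> p = 0") auto

lemma rpoly_add: "rpoly (p + q) x = rpoly p x + rpoly q x"
  by (simp add: rat_poly_integral.hom_add)

lemma rpoly_mult: "rpoly (p * q) x = rpoly p x * rpoly q x"
  by (simp add: rat_poly_integral.hom_mult)

lemma rpoly_altdef: "rpoly p x = (\<Sum>i\<le>degree p. of_rat (coeff p i) * x ^ i)"
  by (simp add: poly_altdef coeff_map_poly degree_map_poly)

section \<open>The ring generated by one element\<close>

text \<open>This is Q[x]. By \<open>adjoin_inverse\<close> it is the field Q(x) when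
  \<open>x\<close> is algebraic.\<close>

definition adjoin :: "'a::field_char_0 \<Rightarrow> 'a set" where
  "adjoin x = range (\<lambda>p. rpoly p x)"

lemma adjoinI: "u = rpoly p x \<Longrightarrow> u \<in> adjoin x"
  unfolding adjoin_def by simp

lemma adjoin_self: "x \<in> adjoin x"
  by (rule adjoinI[of _ "[:0, 1:]"]) (simp add: rpoly_pCons)

lemma adjoin_of_rat: "of_rat q \<in> adjoin x"
  by (rule adjoinI[of _ "[:q:]"]) (simp add: rpoly_pCons)

lemma adjoin_add: "u \<in> adjoin x \<Longrightarrow> v \<in> adjoin x \<Longrightarrow> u + v \<in> adjoin x"
  by (auto simp: adjoin_def simp flip: rpoly_add)

lemma adjoin_mult: "u \<in> adjoin x \<Longrightarrow> v \<in> adjoin x \<Longrightarrow> u * v \<in> adjoin x"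
  by (auto simp: adjoin_def simp flip: rpoly_mult)

lemma adjoin_minus: "u \<in> adjoin x \<Longrightarrow> - u \<in> adjoin x"
  using adjoin_mult[OF _ adjoin_of_rat, of u x "- 1"] by (simp add: of_rat_minus)

lemma adjoin_diff: "u \<in> adjoin x \<Longrightarrow> v \<in> adjoin x \<Longrightarrow> u - v \<in> adjoin x"
  using adjoin_add[OF _ adjoin_minus, of u x v] by simp

lemma adjoin_subset: "u \<in> adjoin x \<Longrightarrow> adjoin u \<subseteq> adjoin x"
proof -
  assume "u \<in> adjoin x"
  then have "rpoly p u \<in> adjoin x" for p
    by (induction p)
       (use adjoin_of_rat[of 0 x] in \<open>auto simp: rpoly_pCons intro!: adjoin_add adjoin_mult adjoin_of_rat\<close>)
  then show ?thesis by (auto simp: adjoin_def[of u])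
qed

text \<open>\<open>u\<close> is itself algebraic. From a nonzero relation for \<open>u\<close>,
  factors of \<open>u\<close> are cancelled until the constant term is nonzero; that term, moved to
  the other side, exhibits the inverse as a polynomial in \<open>u\<close>.\<close>

lemma adjoin_inverse:
  assumes "rat_integral.integral x" "u \<in> adjoin x"
  shows "inverse u \<in> adjoin x"
proof (cases "u = 0")
  case True
  then show ?thesis using adjoin_of_rat[of 0 x] by simp
next
  case False
  have "inverse u \<in> adjoin u" if "p \<noteq> 0" "rpoly p u = 0" for p
    using that
  proof (induction p)
    case (pCons c q)
    show ?case
    proof (cases "c = 0")
      case True
      then show ?thesis using pCons False by (auto simp: rpoly_pCons)
    next
      case c: False
      have "of_rat c + u * rpoly q u = 0" using pCons.prems by (simp add: rpoly_pCons)
      then have "u * rpoly q u = - of_rat c" by (simp add: eq_neg_iff_add_eq_0 add.commute)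
      then have "u * (of_rat (- inverse c) * rpoly q u) = 1"
        using c by (simp add: of_rat_minus of_rat_inverse mult.left_commute[of u])
      then have "inverse u = of_rat (- inverse c) * rpoly q u" by (rule inverse_unique)
      also have "\<dots> \<in> adjoin u" by (intro adjoin_mult adjoin_of_rat adjoinI[OF refl])
      finally show ?thesis .
    qed
  qed simp
  moreover have "rat_integral.integral u"
    using assms rat_integral.integral_poly_hom unfolding adjoin_def by auto
  ultimately have "inverse u \<in> adjoin u"
    unfolding rat_integral.integral_def by (metis leading_coeff_0_iff zero_neq_one)
  then show ?thesis using adjoin_subset[OF assms(2)] by blast
qed

section \<open>Minimal polynomials and degrees\<close>

text \<open>A monic annihilator of least degree divides every annihilator, as the remainder must
  vanish. This makes it irreducible and the only monic irreducible annihilator, which resolves the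
  definite description in \<open>rat_minpoly\<close>.\<close>

lemma rat_minpoly:
  fixes x :: "'a::field_char_0"
  assumes "rat_integral.integral x"
  shows "monic (rat_minpoly x)" "rpoly (rat_minpoly x) x = 0"
    and degree_rat_minpoly_le: "\<And>q. q \<noteq> 0 \<Longrightarrow> rpoly q x = 0 \<Longrightarrow> degree (rat_minpoly x) \<le> degree q"
proof -
  define is_min where "is_min = (\<lambda>p. monic p \<and> Factorial_Ring.irreducible p \<and> rpoly p x = 0)"
  obtain p where p: "monic p" "rpoly p x = 0"
    and p_min: "\<And>q. monic q \<Longrightarrow> rpoly q x = 0 \<Longrightarrow> degree p \<le> degree q"
    using assms ex_has_least_nat[of "\<lambda>p. monic p \<and> rpoly p x = 0" _ degree]
    unfolding rat_integral.integral_def by blast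
  have min: "degree p \<le> degree q" if "q \<noteq> 0" "rpoly q x = 0" for q
    using p_min[of "Polynomial.smult (inverse (lead_coeff q)) q"] that
    by (simp add: of_rat_hom.map_poly_hom_smult)
  have dvd: "p dvd q" if "rpoly q x = 0" for q
  proof -
    have "rpoly q x = rpoly (q div p) x * rpoly p x + rpoly (q mod p) x"
      by (metis div_mult_mod_eq rpoly_add rpoly_mult)
    then have "rpoly (q mod p) x = 0" using that p(2) by simp
    then have "q mod p = 0"
      using min[of "q mod p"] degree_mod_less[of p q] p(1) by fastforce
    then show ?thesis by blast
  qed
  have "p \<noteq> 0" using p(1) by auto
  have unit: "is_unit b" if "p = a * b" "rpoly a x = 0" for a b
  proof -
    have "a \<noteq> 0" "b \<noteq> 0" using that \<open>p \<noteq> 0\<close> by auto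
    then have "degree b = 0"
      using min[OF _ that(2)] that(1) by (simp add: degree_mult_eq)
    then show ?thesis using \<open>b \<noteq> 0\<close> is_unit_iff_degree by blast
  qed
  have "Factorial_Ring.irreducible p"
  proof (rule irreducibleI)
    show "p \<noteq> 0" by fact
    show "\<not> is_unit p"
    proof
      assume "is_unit p"
      then have "degree p = 0" using \<open>p \<noteq> 0\<close> is_unit_iff_degree by blast
      then have "p = 1" using p(1) monic_degree_0 by blast
      then show False using p(2) by simp
    qed
    fix a b assume ab: "p = a * b"
    then have "rpoly a x = 0 \<or> rpoly b x = 0" using p(2) by (simp add: rpoly_mult)
    then show "is_unit a \<or> is_unit b" using unit ab by (metis mult.commute)
  qed
  then have "is_min p" using p unfolding is_min_def by simp
  moreover have "q = p" if "is_min q" for q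
  proof -
    have "p dvd q" "Factorial_Ring.irreducible q" "monic q" using that dvd unfolding is_min_def by auto
    then have "q dvd p" using irreducibleD' \<open>Factorial_Ring.irreducible p\<close> irreducible_not_unit by blast
    then show ?thesis using \<open>p dvd q\<close> p(1) \<open>monic q\<close> by (simp add: poly_dvd_antisym)
  qed
  ultimately have "rat_minpoly x = p"
    unfolding rat_minpoly_def is_min_def by (intro the_equality) blast+
  then show "monic (rat_minpoly x)" "rpoly (rat_minpoly x) x = 0"
    "\<And>q. q \<noteq> 0 \<Longrightarrow> rpoly q x = 0 \<Longrightarrow> degree (rat_minpoly x) \<le> degree q"
    using p min by auto
qed

text \<open>The powers of \<open>x\<close> below the degree form a basis: minimality gives
  independence, division with remainder by the minimal polynomial gives spanning.\<close>

lemma dim_adjoin: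
  assumes "rat_integral.integral x"
  shows "rat_vs.dim (adjoin x) = rat_degree x"
proof -
  let ?p = "rat_minpoly x" let ?d = "rat_degree x"
  note p = rat_minpoly[OF assms, folded rat_degree_def]
  define B where "B = (\<lambda>i. x ^ i) ` {..<?d}"
  have zero: "q = 0" if "degree q < ?d" "rpoly q x = 0" for q
    using p(3)[of q] that by fastforce
  have p0: "?p \<noteq> 0" using p(1) by auto
  \<comment> \<open>\<open>B\<close> is a set, so its cardinality is \<open>?d\<close> only if these
    powers are distinct.\<close>
  have inj: "inj_on (\<lambda>i. x ^ i) {..<?d}"
  proof (rule inj_onI)
    fix i j assume ij: "i \<in> {..<?d}" "j \<in> {..<?d}" "x ^ i = x ^ j"
    let ?q = "monom 1 i - monom 1 j :: rat poly"
    have "degree ?q \<le> max i j" by (intro degree_diff_le) (auto simp: degree_monom_eq)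
    then have "degree ?q < ?d" using ij by auto
    moreover have "rpoly ?q x = 0" 
      using ij(3) by (simp add: rat_poly_integral.hom_minus map_poly_monom poly_monom)
    ultimately have "?q = 0" by (rule zero)
    then show "i = j" by (simp add: monom_eq_iff')
  qed
  have "rat_vs.independent B"
    unfolding rat_vs.independent_explicit_finite_subsets
  proof (intro allI impI ballI)
    fix S u v assume S: "S \<subseteq> B" "finite S" "(\<Sum>v\<in>S. of_rat (u v) * v) = 0" "v \<in> S"
    define I where "I = {i. i < ?d \<and> x ^ i \<in> S}"
    have I: "S = (\<lambda>i. x ^ i) ` I" "finite I" "I \<subseteq> {..<?d}"
      using S(1) unfolding I_def B_def by auto
    define q where "q = (\<Sum>i\<in>I. monom (u (x ^ i)) i)"
    have coeff: "coeff q j = (if j \<in> I then u (x ^ j) else 0)" for j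
      unfolding q_def using I(2) by (simp add: coeff_sum)
    \<comment> \<open>The zero polynomial has degree 0, so the strict bound on
      \<open>degree q\<close> requires a positive \<open>?d\<close>; the element \<open>v\<close> of
      \<open>B\<close> provides it.\<close>
    have "?d > 0" using S by (auto simp: B_def)
    then have "degree q < ?d"
      using coeff I(3) by (intro degree_lessI) auto
    moreover have "rpoly q x = (\<Sum>i\<in>I. of_rat (u (x ^ i)) * x ^ i)"
      unfolding q_def by (simp add: rat_poly_integral.hom_sum map_poly_monom poly_monom poly_sum)
    moreover have "\<dots> = 0"
      using S(3) inj_on_subset[OF inj I(3)] unfolding I(1) by (simp add: sum.reindex)
    ultimately have "q = 0" using zero by simp
    then show "u v = 0" using coeff S(4) I(1) by (metis coeff_0 imageE)
  qed
  moreover have "B \<subseteq> adjoin x"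
  proof -
    have "x ^ i \<in> adjoin x" for i
      by (rule adjoinI[of _ "monom 1 i"]) (simp add: map_poly_monom poly_monom)
    then show ?thesis unfolding B_def by auto
  qed
  moreover have "adjoin x \<subseteq> rat_vs.span B"
  proof
    fix u assume "u \<in> adjoin x"
    then obtain q where q: "u = rpoly q x" unfolding adjoin_def by auto
    let ?r = "q mod ?p"
    have "u = rpoly (q div ?p) x * rpoly ?p x + rpoly ?r x"
      unfolding q by (metis div_mult_mod_eq rpoly_add rpoly_mult)
    then have "u = (\<Sum>i\<le>degree ?r. of_rat (coeff ?r i) * x ^ i)"
      using p(2) by (simp add: rpoly_altdef)
    moreover have "of_rat (coeff ?r i) * x ^ i \<in> rat_vs.span B" for i
    proof (cases "i < ?d")
      case True
      then show ?thesis unfolding B_def by (intro rat_vs.span_scale rat_vs.span_base) auto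
    next
      case False
      then have "coeff ?r i = 0"
        using degree_mod_less[OF p0, of q] unfolding rat_degree_def
        by (metis coeff_0 coeff_eq_0 le_less_trans not_less)
      then show ?thesis using rat_vs.span_zero by simp
    qed
    ultimately show "u \<in> rat_vs.span B" by (auto intro: rat_vs.span_sum)
  qed
  ultimately show ?thesis
    using rat_vs.dim_unique[of B "adjoin x"] inj unfolding B_def by (simp add: card_image)
qed

section \<open>Generic linear combinations\<close>

text \<open>A relation over Q is also one over Q[T], with constant coefficients.\<close>

lemma integral_const_poly:
  assumes "rat_integral.integral a"
  shows "rat_poly_integral.integral [:a:]"
proof -
  obtain p where p: "monic p" "rpoly p a = 0"
    using assms unfolding rat_integral.integral_def by blast
  define P where "P = map_poly (\<lambda>c. [:c:]) p"
  have "degree P = degree p" unfolding P_def by (rule degree_map_poly) simp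
  then have "monic P" using p(1) unfolding P_def by (simp add: coeff_map_poly one_pCons)
  moreover have "poly (map_poly (map_poly of_rat) (map_poly (\<lambda>c. [:c:]) q)) [:a:] = [:rpoly q a:]" for q
  proof (induction q)
    case (pCons c q)
    then show ?case by (cases "c = 0") (simp_all add: rpoly_pCons)
  qed simp
  ultimately show ?thesis
    using p(2) unfolding rat_poly_integral.integral_def P_def by (metis pCons_0_0)
qed

text \<open>
  Let \<open>P(T, X)\<close> be nonzero, of minimal degree in \<open>X\<close>, with \<open>P(T, \<alpha> + T \<beta>) = 0\<close>. Differentiating with
  respect to \<open>T\<close> gives \<open>P\<^sub>T + \<beta> P\<^sub>X = 0\<close> at \<open>(T, \<alpha> + T \<beta>)\<close>, and \<open>P\<^sub>X(T, \<alpha> + T \<beta>) \<noteq> 0\<close> by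
  minimality. Hence \<open>\<beta>\<close> is a rational function of \<open>t\<close> and \<open>\<alpha> + t \<beta>\<close> for almost all \<open>t\<close>.
\<close>

lemma finite_nongenerating:
  fixes \<alpha> \<beta> :: "'a::field_char_0"
  assumes "rat_integral.integral \<alpha>" "rat_integral.integral \<beta>"
  shows "finite {t. \<beta> \<notin> adjoin (\<alpha> + of_rat t * \<beta>)}"
proof -
  \<comment> \<open>\<open>ev P\<close> is P(T, \<alpha> + T \<beta>): the coefficients of
    \<open>P\<close> are polynomials in T, and its outer variable is X.\<close>
  define ev where "ev = (\<lambda>P. poly (map_poly (map_poly of_rat) P) [:\<alpha>, \<beta>:])"
  have ev_0: "ev 0 = 0" unfolding ev_def by simp
  have ev_pCons: "ev (pCons c P) = map_poly of_rat c + [:\<alpha>, \<beta>:] * ev P" for c P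
    unfolding ev_def by (cases "c = 0 \<and> P = 0") auto
  interpret mp: map_poly_comm_ring_hom "map_poly of_rat :: rat poly \<Rightarrow> 'a poly" ..
  have ev_add: "ev (P + Q) = ev P + ev Q" for P Q
    unfolding ev_def by (simp add: mp.hom_add)
  have "[:\<alpha>, \<beta>:] = [:\<alpha>:] + map_poly of_rat [:0, 1:] * [:\<beta>:]"
    by simp
  also have "rat_poly_integral.integral \<dots>"
    using assms by (intro rat_poly_integral.integral_add_mult integral_const_poly
      rat_poly_integral.integral_hom)
  finally obtain P0 where "P0 \<noteq> 0" "ev P0 = 0"
    unfolding rat_poly_integral.integral_def ev_def by (metis leading_coeff_0_iff zero_neq_one)
  then obtain P where P: "P \<noteq> 0" "ev P = 0"
    and P_min: "\<And>Q. Q \<noteq> 0 \<Longrightarrow> ev Q = 0 \<Longrightarrow> degree P \<le> degree Q"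
    using ex_has_least_nat[of "\<lambda>P. P \<noteq> 0 \<and> ev P = 0" P0 degree] by blast
  \<comment> \<open>A relation free of X would be a nonzero polynomial in T that is identically
    zero.\<close>
  have deg: "degree P \<noteq> 0"
  proof
    assume "degree P = 0"
    then obtain c where c: "P = [:c:]" by (rule degree_eq_zeroE)
    then have "map_poly of_rat c = (0 :: 'a poly)" using P(2) by (simp add: ev_pCons ev_0)
    then show False using P(1) c by simp
  qed
  define V where "V = ev (pderiv P)"
  have "pderiv P \<noteq> 0" using deg by (simp add: pderiv_eq_0_iff)
  moreover have "degree (pderiv P) < degree P" using deg by (simp add: degree_pderiv)
  ultimately have "V \<noteq> 0" using P_min[of "pderiv P"] unfolding V_def by auto
  have pderiv_linear: "pderiv [:\<alpha>, \<beta>:] = [:\<beta>:]" by (simp add: pderiv_pCons)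
  \<comment> \<open>The chain rule: \<open>map_poly pderiv\<close> differentiates in T, the outer
    \<open>pderiv\<close> in X.\<close>
  have chain: "pderiv (ev Q) = ev (map_poly pderiv Q) + [:\<beta>:] * ev (pderiv Q)" for Q
  proof (induction Q)
    case (pCons c Q)
    have "pderiv (ev (pCons c Q)) =
        map_poly of_rat (pderiv c) + [:\<beta>:] * ev Q + [:\<alpha>, \<beta>:] * pderiv (ev Q)"
      unfolding ev_pCons pderiv_add pderiv_mult pderiv_linear of_rat_hom.map_poly_pderiv
      by (simp only: ac_simps)
    also have "\<dots> = ev (map_poly pderiv (pCons c Q)) + [:\<beta>:] * ev (pderiv (pCons c Q))"
      using pCons.hyps unfolding pCons.IH pderiv_pCons
      by (simp add: ev_pCons ev_add algebra_simps del: mult_pCons_left mult_pCons_right)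
    finally show ?case .
  qed (simp add: ev_0)
  \<comment> \<open>Setting T = \<open>t\<close> with \<open>t\<close> rational leaves a rational
    polynomial in \<alpha> + t \<beta>.\<close>
  have ev_adjoin: "poly (ev Q) (of_rat t) \<in> adjoin (\<alpha> + of_rat t * \<beta>)" for Q t
  proof (induction Q)
    case 0
    show ?case using adjoin_of_rat[of 0] by (simp add: ev_0)
  next
    case (pCons c Q)
    have "poly (ev (pCons c Q)) (of_rat t)
        = of_rat (poly c t) + (\<alpha> + of_rat t * \<beta>) * poly (ev Q) (of_rat t)"
      unfolding ev_pCons by (simp add: algebra_simps)
    then show ?case
      using pCons.IH by (simp add: adjoin_add adjoin_mult adjoin_of_rat adjoin_self)
  qed
  have "\<beta> \<in> adjoin (\<alpha> + of_rat t * \<beta>)" if t: "poly V (of_rat t) \<noteq> 0" for t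
  proof -
    let ?U = "ev (map_poly pderiv P)"
    have "?U + [:\<beta>:] * V = 0" using chain[of P] P(2) unfolding V_def by simp
    then have "poly (?U + [:\<beta>:] * V) (of_rat t) = 0" by simp
    then have "\<beta> = - (poly ?U (of_rat t) * inverse (poly V (of_rat t)))"
      using t by (simp add: field_simps eq_neg_iff_add_eq_0)
    moreover have "rat_integral.integral (\<alpha> + of_rat t * \<beta>)"
      using assms by (intro rat_integral.integral_add_mult rat_integral.integral_hom)
    ultimately show ?thesis
      using ev_adjoin unfolding V_def
      by (metis adjoin_inverse adjoin_minus adjoin_mult)
  qed
  then have "{t. \<beta> \<notin> adjoin (\<alpha> + of_rat t * \<beta>)} \<subseteq> of_rat -` {z. poly V z = 0}" by auto
  moreover have "finite (of_rat -` {z. poly V z = 0} :: rat set)"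
    using \<open>V \<noteq> 0\<close> by (intro finite_vimageI poly_roots_finite) (auto simp: inj_def)
  ultimately show ?thesis by (rule finite_subset)
qed

section \<open>Number fields\<close>

lemma common_denominator:
  "finite A \<Longrightarrow> \<exists>d::int. d > 0 \<and> (\<forall>q\<in>A. of_int d * (q::rat) \<in> \<int>)"
proof (induction A rule: finite_induct)
  case empty
  show ?case by (intro exI[of _ 1]) simp
next
  case (insert q A)
  then obtain d where d: "d > 0" "\<forall>q\<in>A. of_int d * q \<in> \<int>" by blast
  obtain a b where q: "q = of_int a / of_int b" "b > 0"
    by (metis Rat_cases Fract_of_int_quotient)
  have "of_int (b * d) * q = of_int (d * a)" using q by simp
  then have "of_int (b * d) * q \<in> \<int>" by (metis Ints_of_int)
  moreover have "of_int (b * d) * r \<in> \<int>" if "r \<in> A" for r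
    using d(2) that Ints_mult[OF Ints_of_int[of b], of "of_int d * r"] by (simp add: mult.assoc)
  ultimately show ?case
    using d(1) q(2) by (intro exI[of _ "b * d"]) simp
qed

lemma number_fieldD:
  assumes "number_field K"
  shows "0 \<in> K" "1 \<in> K"
    and number_field_add: "\<And>x y. x \<in> K \<Longrightarrow> y \<in> K \<Longrightarrow> x + y \<in> K"
    and number_field_mult: "\<And>x y. x \<in> K \<Longrightarrow> y \<in> K \<Longrightarrow> x * y \<in> K"
    and number_field_inverse: "\<And>x. x \<in> K \<Longrightarrow> inverse x \<in> K"
    and number_field_of_rat: "\<And>q. of_rat q \<in> K"
proof -
  obtain B where "rat_vs.span B = K" using assms unfolding number_field_def by blast
  moreover have "1 \<in> K" using assms unfolding number_field_def subfield_set_def by blast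
  ultimately show "of_rat q \<in> K" for q using rat_vs.span_scale[of 1 B q] by simp
qed (use assms in \<open>auto simp: number_field_def subfield_set_def\<close>)

lemma adjoin_subset_number_field:
  assumes K: "number_field K" and "x \<in> K"
  shows "adjoin x \<subseteq> K"
proof -
  have "rpoly p x \<in> K" for p
    by (induction p)
       (auto simp: rpoly_pCons assms(2) intro!: number_fieldD[OF K])
  then show ?thesis unfolding adjoin_def by auto
qed

text \<open>Multiplication by \<open>x\<close> acts on a finite spanning set through a rational
  matrix. If \<open>d\<close> clears its denominators, \<open>d * x\<close> acts through an integer
  matrix, and \<open>integral_if_stable\<close> applies.\<close>

lemma number_field_scale_integral:
  assumes K: "number_field K" and x: "x \<in> K"
  shows "\<exists>d::int. d > 0 \<and> algebraic_int (of_int d * x)"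
proof -
  obtain B where B: "finite B" "rat_vs.span B = K" using K unfolding number_field_def by blast
  have "\<exists>c. x * b = (\<Sum>b'\<in>B. of_rat (c b') * b')" if "b \<in> B" for b
  proof -
    have "x * b \<in> rat_vs.span B"
      using that x B(2) rat_vs.span_base number_field_mult[OF K] by blast
    then show ?thesis unfolding rat_vs.span_finite[OF B(1)] by auto
  qed
  then obtain c where c: "\<And>b. b \<in> B \<Longrightarrow> x * b = (\<Sum>b'\<in>B. of_rat (c b b') * b')" by metis
  obtain d :: int where d: "d > 0" "\<forall>q\<in>(\<lambda>(b, b'). c b b') ` (B \<times> B). of_int d * q \<in> \<int>"
    using common_denominator[of "(\<lambda>(b, b'). c b b') ` (B \<times> B)"] B(1) by blast
  \<comment> \<open>The floor merely converts integral rationals to type \<open>int\<close>.\<close>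
  define e where "e = (\<lambda>b b'. \<lfloor>of_int d * c b b'\<rfloor>)"
  have e: "of_int (e b b') = (of_int d * of_rat (c b b') :: 'a)" if "b \<in> B" "b' \<in> B" for b b'
  proof -
    have "of_int d * c b b' \<in> \<int>" using d(2) that by auto
    then have "of_int (e b b') = of_int d * c b b'" unfolding e_def by (rule of_int_floor)
    then have "of_rat (of_int (e b b')) = (of_rat (of_int d * c b b') :: 'a)" by simp
    then show ?thesis by (simp add: of_rat_mult)
  qed
  \<comment> \<open>A nonzero generator exists because the span contains 1.\<close>
  obtain k where k: "k \<in> B" "k \<noteq> 0"
  proof -
    have "B \<subseteq> {0} \<Longrightarrow> rat_vs.span B = {0}"
      using rat_vs.span_mono[of B "{0}"] rat_vs.span_zero[of B] by auto
    then show ?thesis using that B(2) number_fieldD(2)[OF K] by force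
  qed
  have "of_int d * x * b \<in> int_integral.lin_span B (\<lambda>b. b)" if "b \<in> B" for b
    unfolding int_integral.lin_span_def
  proof (rule range_eqI[where x = "e b"])
    show "of_int d * x * b = (\<Sum>b'\<in>B. of_int (e b b') * b')"
      using that by (simp add: mult.assoc c sum_distrib_left e)
  qed
  then have "int_integral.integral (of_int d * x)"
    using k by (intro int_integral.integral_if_stable[where I = B and b = "\<lambda>b. b" and k = k, OF B(1)])
  then show ?thesis using d(1) unfolding algebraic_int_iff_integral by blast
qed

lemma algebraic_int_add_mult:
  fixes x y :: "'a::field_char_0"
  assumes "algebraic_int x" "algebraic_int y"
  shows "algebraic_int (x + y)" "algebraic_int (x * y)"
  using assms int_integral.integral_add_mult[of x y] unfolding algebraic_int_iff_integral by auto

lemma algebraic_int_of_int: "algebraic_int (of_int m :: 'a::field_char_0)"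
  unfolding algebraic_int_iff_integral by (rule int_integral.integral_hom)

lemma number_field_common_scale:
  assumes K: "number_field K" and "finite A" "A \<subseteq> K"
  shows "\<exists>d::int. d > 0 \<and> (\<forall>x\<in>A. algebraic_int (of_int d * x))"
  using assms(2,3)
proof (induction A rule: finite_induct)
  case empty
  show ?case by (intro exI[of _ 1]) simp
next
  case (insert a A)
  then obtain d :: int where d: "d > 0" "\<forall>x\<in>A. algebraic_int (of_int d * x)" by auto
  obtain e :: int where e: "e > 0" "algebraic_int (of_int e * a)"
    using number_field_scale_integral[OF K] insert.prems by auto
  have "algebraic_int (of_int (e * d) * a)"
    using algebraic_int_add_mult(2)[OF algebraic_int_of_int[of d] e(2)] by (simp add: ac_simps)
  moreover have "algebraic_int (of_int (e * d) * x)" if "x \<in> A" for x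
    using algebraic_int_add_mult(2)[OF algebraic_int_of_int[of e], of "of_int d * x"] d(2) that
    by (simp add: ac_simps)
  ultimately show ?case using d(1) e(1) by (intro exI[of _ "e * d"]) auto
qed

text \<open>Some positive integer multiple of \<open>x\<close> is an algebraic integer, hence
  algebraic over Q, and division by that integer preserves this.\<close>

lemma number_field_rat_integral:
  assumes K: "number_field K" and "x \<in> K"
  shows "rat_integral.integral x"
proof -
  obtain d :: int where d: "d > 0" "algebraic_int (of_int d * x)"
    using number_field_scale_integral[OF assms] by blast
  then obtain p :: "int poly" where p: "monic p" "poly (map_poly of_int p) (of_int d * x) = 0"
    unfolding algebraic_int_iff_integral int_integral.integral_def by blast
  have "map_poly of_rat (map_poly of_int p) = (map_poly of_int p :: 'a poly)"
    by (simp add: map_poly_map_poly o_def)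
  then have "rat_integral.integral (of_int d * x)"
    using p unfolding rat_integral.integral_def
    by (intro exI[of _ "map_poly of_int p"]) (auto simp: coeff_map_poly degree_map_poly)
  then have "rat_integral.integral (of_rat (inverse (of_int d)) * (of_int d * x))"
    by (rule rat_integral.integral_add_mult(2)[OF rat_integral.integral_hom])
  moreover have "of_rat (inverse (of_int d)) * (of_int d * x) = x"
    using d(1) by (simp add: of_rat_inverse)
  ultimately show ?thesis by simp
qed

section \<open>Primitive elements\<close>

lemma adjoin_first_summand:
  assumes "\<beta> \<in> adjoin (\<alpha> + of_rat t * \<beta>)"
  shows "\<alpha> \<in> adjoin (\<alpha> + of_rat t * \<beta>)"
proof -
  have "(\<alpha> + of_rat t * \<beta>) - of_rat t * \<beta> \<in> adjoin (\<alpha> + of_rat t * \<beta>)"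
    by (intro adjoin_diff adjoin_mult adjoin_of_rat adjoin_self assms)
  then show ?thesis by simp
qed

text \<open>The elements of a finite spanning set are absorbed one at a time: for all but finitely
  many rational \<open>t\<close>, \<theta> + t b generates \<open>b\<close>, hence \<theta> and
  everything \<theta> generates.\<close>

lemma primitive_element:
  assumes K: "number_field K"
  shows "\<exists>\<theta>\<in>K. K \<subseteq> adjoin \<theta>"
proof -
  obtain B where B: "finite B" "rat_vs.span B = K" using K unfolding number_field_def by blast
  have "B \<subseteq> K" using B(2) rat_vs.span_superset by blast
  with B(1) have "\<exists>\<theta>\<in>K. B \<subseteq> adjoin \<theta>"
  proof (induction B rule: finite_induct)
    case empty
    show ?case using number_fieldD(1)[OF K] by blast
  next
    case (insert b B)
    then obtain \<theta> where \<theta>: "\<theta> \<in> K" "B \<subseteq> adjoin \<theta>" by auto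
    have "b \<in> K" using insert.prems by simp
    have "finite {t. b \<notin> adjoin (\<theta> + of_rat t * b)}"
      by (intro finite_nongenerating number_field_rat_integral[OF K] \<theta>(1) \<open>b \<in> K\<close>)
    then obtain t where t: "b \<in> adjoin (\<theta> + of_rat t * b)"
      using ex_new_if_finite[OF infinite_UNIV_char_0] by blast
    then have "B \<subseteq> adjoin (\<theta> + of_rat t * b)"
      using \<theta>(2) adjoin_subset[OF adjoin_first_summand] by blast
    moreover have "\<theta> + of_rat t * b \<in> K"
      by (intro number_fieldD[OF K] \<theta>(1) \<open>b \<in> K\<close>)
    ultimately show ?case using t by blast
  qed
  then obtain \<theta> where \<theta>: "\<theta> \<in> K" "B \<subseteq> adjoin \<theta>" by blast
  have "rat_vs.subspace (adjoin \<theta>)"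
    using adjoin_of_rat[of 0 \<theta>]
    by (auto simp: rat_vs.subspace_def intro: adjoin_add adjoin_mult adjoin_of_rat)
  then have "K \<subseteq> adjoin \<theta>" using \<theta>(2) B(2) rat_vs.span_minimal by blast
  then show ?thesis using \<theta>(1) by blast
qed

section \<open>Integer-valued polynomials\<close>

lemma int_valued_at_integer:
  assumes K: "number_field K"
    and f: "\<And>i. coeff f i \<in> K"
      "poly f ` integers_of_degree K (rat_vs.dim K) \<subseteq> ring_of_integers K"
    and \<alpha>: "\<alpha> \<in> ring_of_integers K"
  shows "poly f \<alpha> \<in> ring_of_integers K"
proof -
  have \<alpha>': "\<alpha> \<in> K" "algebraic_int \<alpha>" using \<alpha> unfolding ring_of_integers_def by auto
  obtain \<theta> where \<theta>: "\<theta> \<in> K" "K \<subseteq> adjoin \<theta>" using primitive_element[OF K] by blast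
  have "finite (insert \<theta> (range (coeff f)))" by (simp add: range_coeff)
  then obtain d :: int where d: "d > 0" "algebraic_int (of_int d * \<theta>)"
    "\<And>i. algebraic_int (of_int d * coeff f i)"
    using number_field_common_scale[OF K, of "insert \<theta> (range (coeff f))"] \<theta>(1) f(1) by auto
  \<comment> \<open>Injectivity lets the finite set of bad rationals exclude only finitely many
    integers \<open>m\<close>.\<close>
  have "inj (\<lambda>m::int. of_int (d * d * m) :: rat)" using d(1) by (auto simp: inj_def)
  moreover have "finite {t. \<theta> \<notin> adjoin (\<alpha> + of_rat t * \<theta>)}"
    by (intro finite_nongenerating number_field_rat_integral[OF K] \<theta>(1) \<alpha>'(1))
  ultimately have "finite ((\<lambda>m::int. of_int (d * d * m)) -` {t. \<theta> \<notin> adjoin (\<alpha> + of_rat t * \<theta>)})"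
    by (rule finite_vimageI[rotated])
  then obtain m :: int where m: "\<theta> \<in> adjoin (\<alpha> + of_rat (of_int (d * d * m)) * \<theta>)"
    using ex_new_if_finite[OF infinite_UNIV_int] by blast
  define \<gamma> where "\<gamma> = \<alpha> + of_rat (of_int (d * d * m)) * \<theta>"
  \<comment> \<open>One factor \<open>d\<close> makes \<open>d\<close> \<theta> integral; the other
    will cancel the denominator of \<open>f\<close>.\<close>
  have \<gamma>_eq: "\<gamma> = \<alpha> + of_int (d * m) * (of_int d * \<theta>)"
    unfolding \<gamma>_def by (simp add: of_rat_mult algebra_simps)
  have \<gamma>: "\<gamma> \<in> K" "algebraic_int \<gamma>"
    unfolding \<gamma>_def by (intro number_fieldD[OF K] \<theta>(1) \<alpha>'(1))
      (fold \<gamma>_def, unfold \<gamma>_eq, intro algebraic_int_add_mult algebraic_int_of_int d(2) \<alpha>'(2))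
  \<comment> \<open>\<gamma> generates \<theta> and so all of \<open>K\<close>; by
    \<open>dim_adjoin\<close> its degree is then the dimension of \<open>K\<close>.\<close>
  have "adjoin \<gamma> = K"
    using adjoin_subset_number_field[OF K \<gamma>(1)] adjoin_subset[OF m] \<theta>(2) unfolding \<gamma>_def by blast
  then have "rat_degree \<gamma> = rat_vs.dim K"
    using dim_adjoin[OF number_field_rat_integral[OF K \<gamma>(1)]] by simp
  then have "\<gamma> \<in> integers_of_degree K (rat_vs.dim K)"
    using \<gamma> unfolding integers_of_degree_def ring_of_integers_def by simp
  then have f\<gamma>: "poly f \<gamma> \<in> K" "algebraic_int (poly f \<gamma>)"
    using f(2) unfolding ring_of_integers_def by auto
  let ?g = "Polynomial.smult (of_int d) f"
  obtain s where s: "algebraic_int s" "poly ?g \<gamma> - poly ?g \<alpha> = (\<gamma> - \<alpha>) * s"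
    using int_integral.integral_poly_diff[of ?g \<alpha> \<gamma>] d(3) \<gamma>(2) \<alpha>'(2)
    unfolding algebraic_int_iff_integral by auto
  have "of_int d * (poly f \<gamma> - poly f \<alpha>) = of_int d * (of_int m * (of_int d * \<theta>) * s)"
    using s(2) unfolding \<gamma>_eq by (simp add: algebra_simps)
  then have "poly f \<gamma> - poly f \<alpha> = of_int m * (of_int d * \<theta>) * s"
    using d(1) by simp
  then have "poly f \<alpha> = poly f \<gamma> + of_int (- m) * (of_int d * \<theta>) * s"
    by (simp add: algebra_simps)
  also have "algebraic_int \<dots>"
    by (intro algebraic_int_add_mult algebraic_int_of_int f\<gamma>(2) d(2) s(1))
  finally have "algebraic_int (poly f \<alpha>)" .
  \<comment> \<open>Besides being integral, the value must lie in \<open>K\<close>; generalising to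
    \<open>g\<close> permits induction.\<close>
  moreover have "poly g \<alpha> \<in> K" if "\<And>i. coeff g i \<in> K" for g
    using that
  proof (induction g)
    case (pCons c g)
    have "c \<in> K" using pCons.prems[of 0] by simp
    moreover have "poly g \<alpha> \<in> K" using pCons.prems[of "Suc _"] by (intro pCons.IH) simp
    ultimately show ?case using \<alpha>'(1) by (simp add: number_fieldD[OF K])
  qed (simp add: number_fieldD[OF K])
  ultimately show ?thesis using f(1) unfolding ring_of_integers_def by blast
qed

theorem theorem1p1:
  fixes K :: "'a::field_char_0 set" and n :: nat
  assumes "number_field K" and "rat_vs.dim K = n"
  shows "polynomially_dense (integers_of_degree K n) (ring_of_integers K) \<and>
         int_valued K (integers_of_degree K n) (ring_of_integers K) =
         int_valued K (ring_of_integers K) (ring_of_integers K)"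
proof -
  let ?S = "integers_of_degree K n" and ?D = "ring_of_integers K"
  have sub: "?S \<subseteq> ?D" unfolding integers_of_degree_def by blast
  \<comment> \<open>Both claims are instances: \<open>F\<close> is \<open>K\<close> or the quotient
    field of \<open>?D\<close>, which lies in \<open>K\<close>.\<close>
  have eq: "int_valued F ?S ?D = int_valued F ?D ?D" if "F \<subseteq> K" for F
  proof
    show "int_valued F ?S ?D \<subseteq> int_valued F ?D ?D"
      using int_valued_at_integer[OF assms(1)] that
      unfolding int_valued_def assms(2) by blast
    show "int_valued F ?D ?D \<subseteq> int_valued F ?S ?D"
      using sub unfolding int_valued_def by blast
  qed
  have "a / b \<in> K" if "a \<in> ?D" "b \<in> ?D" for a b
    using that number_fieldD[OF assms(1)] unfolding ring_of_integers_def divide_inverse by blast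
  then have "quotient_field ?D \<subseteq> K" unfolding quotient_field_def by blast
  then show ?thesis using sub eq unfolding polynomially_dense_def by blast
qed

end
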